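(* Let $J\in\mathbb{N}$, let $\boldsymbol{c}^{(J)}$ be a real-valued sequence, and let $\mathcal{S}_{\boldsymbol{\alpha}}$ be a refinement operator with mask $\boldsymbol{\alpha}$ and with pseudo-reverse $\mathcal{D}_{\boldsymbol{\gamma}}$ for some $\xi>0$. Let $\{\boldsymbol{c}^{(0)};\boldsymbol{d}^{(1)},\dots,\boldsymbol{d}^{(J)}\}$ be the multiscale representation of $\boldsymbol{c}^{(J)}$ using $\mathcal{S}_{\boldsymbol{\alpha}}$ and $\mathcal{D}_{\boldsymbol{\gamma}}$. Then there exists $C>0$ such that $$\|\boldsymbol{c}^{(J)}-\boldsymbol{\zeta}^{(J)}\|_\infty\le C\sum_{\ell=1}^J\|\boldsymbol{d}^{(\ell)}\downarrow2\|_\infty,$$ where $\boldsymbol{\zeta}^{(J)}$ is the sequence synthesized from the representation after setting all even-indexed detail coefficients to zero; that is, $\boldsymbol{\zeta}^{(0)}=\boldsymbol{c}^{(0)}$ and $\boldsymbol{\zeta}^{(\ell)}=\mathcal{S}_{\boldsymbol{\alpha}}\boldsymbol{\zeta}^{(\ell-1)}+\boldsymbol{q}^{(\ell)}$ for $\ell=1,\dots,J$, with $q^{(\ell)}_{2n+1}=d^{(\ell)}_{2n+1}$ and $q^{(\ell)}_{2n}=0$ for all $n\in\mathbb{Z}$.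
   Context: Sequences are indexed by $\mathbb{Z}$; at scale $\ell$ the index $j$ corresponds to the grid point $2^{-\ell}j$. For a sequence $\boldsymbol{b}$, $(\boldsymbol{b}\downarrow 2)_j=b_{2j}$, and its symbol is $\boldsymbol{b}(z)=\sum_{k\in\mathbb{Z}}b_kz^k$. $\|\boldsymbol{b}\|_\infty=\sup_j|b_j|\in[0,\infty]$; $\mathbb{T}=\{z\in\mathbb{C}:|z|=1\}$. Refinement operator: for a finitely supported real mask $\boldsymbol{\alpha}$ with $\sum_k\alpha_{2k}=\sum_k\alpha_{2k+1}=1$, $\mathcal{S}_{\boldsymbol{\alpha}}(\boldsymbol{c})_j=\sum_{k\in\mathbb{Z}}\alpha_{j-2k}c_k$. Standing assumption: the subdivision scheme $\mathcal{S}_{\boldsymbol{\alpha}}$ is convergent, i.e. for every bounded $\boldsymbol{c}$ there is a continuous $F:\mathbb{R}\to\mathbb{R}$ with $\lim_{k\to\infty}\sup_j|(\mathcal{S}_{\boldsymbol{\alpha}}^k\boldsymbol{c})_j-F(2^{-k}j)|=0$, with $F\not\equiv0$ for some $\boldsymbol{c}$. Decimation operator: for $\boldsymbol{\gamma}\in\ell_1(\mathbb{Z})$, $\mathcal{D}_{\boldsymbol{\gamma}}(\boldsymbol{c})_j=\sum_{k\in\mathbb{Z}}\gamma_{j-k}c_{2k}$; it is understood that $\boldsymbol{c}^{(J)}$ is such that the decimation series occurring in the representation converge absolutely (e.g. $\boldsymbol{c}^{(J)}$ bounded). Pseudo-reversing: let $p$ be a polynomial with $p(1)=1$ and let $\Lambda$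 be the multiset of its zeros (with multiplicity). For $\xi>0$ put $$p_\xi^{-\dagger}(z)=C_\xi\prod_{r\in\Lambda\setminus\mathbb{T}}(z-r)\prod_{r\in\Lambda\cap\mathbb{T}}(z-(1+\xi)r),$$ with the constant $C_\xi$ determined by $p_\xi^{-\dagger}(1)=1$, and $p_\xi^\dagger=1/p_\xi^{-\dagger}$. For the Laurent polynomial $(\boldsymbol{\alpha}\downarrow2)(z)=z^{-m}q(z)$, with $q$ a polynomial, $q(0)\ne0$, put $(\boldsymbol{\alpha}\downarrow2)_\xi^{-\dagger}(z)=z^{-m}q_\xi^{-\dagger}(z)$ and $(\boldsymbol{\alpha}\downarrow2)_\xi^{\dagger}=1/(\boldsymbol{\alpha}\downarrow2)_\xi^{-\dagger}$. $\mathcal{D}_{\boldsymbol{\gamma}}$ is the pseudo-reverse of $\mathcal{S}_{\boldsymbol{\alpha}}$ for the parameter $\xi$ if $\boldsymbol{\gamma}(z)=(\boldsymbol{\alpha}\downarrow2)_\xi^\dagger(z)$ on $\mathbb{T}$, i.e. $\boldsymbol{\gamma}\in\ell_1(\mathbb{Z})$ is the sequence of Fourier coefficients of this function (which does not vanish and has no poles on $\mathbb{T}$). Multiscale representation of $\boldsymbol{c}^{(J)}$ using $\mathcal{S}_{\boldsymbol{\alpha}},\mathcal{D}_{\boldsymbol{\gamma}}$: recursively for $\ell=J,J-1,\dots,1$, $\boldsymbol{c}^{(\ell-1)}=\mathcal{D}_{\boldsymbol{\gamma}}\boldsymbol{c}^{(\ell)}$ and $\boldsymbol{d}^{(\ell)}=\boldsymbol{c}^{(\ell)}-\mathcal{S}_{\boldsymbol{\alpha}}\boldsymbol{c}^{(\ell-1)}$.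 *)

theory Defs
  imports
    "HOL-Analysis.Analysis"
    "HOL-Computational_Algebra.Polynomial"
begin

type_synonym sequence = "int \<Rightarrow> real"

definition downsample :: "sequence \<Rightarrow> sequence" where
  "downsample b = (\<lambda>j. b (2 * j))"

definition symbol :: "sequence \<Rightarrow> complex \<Rightarrow> complex" where
  "symbol b z = (\<Sum>\<^sub>\<infinity>k. of_real (b k) * z powi k)"

definition sup_norm :: "sequence \<Rightarrow> ennreal" where
  "sup_norm b = (SUP j. ennreal \<bar>b j\<bar>)"


definition refinement_mask :: "sequence \<Rightarrow> bool" where
  "refinement_mask \<alpha> \<longleftrightarrow>
     finite {k. \<alpha> k \<noteq> 0} \<and> (\<Sum>\<^sub>\<infinity>k. \<alpha> (2 * k)) = 1 \<and> (\<Sum>\<^sub>\<infinity>k. \<alpha> (2 * k + 1)) = 1"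

(* For a finitely supported mask only finitely many terms of this sum are nonzero. *)
definition refine :: "sequence \<Rightarrow> sequence \<Rightarrow> sequence" where
  "refine \<alpha> c = (\<lambda>j. \<Sum>\<^sub>\<infinity>k. \<alpha> (j - 2 * k) * c k)"

definition subdivision_limit :: "sequence \<Rightarrow> sequence \<Rightarrow> (real \<Rightarrow> real) \<Rightarrow> bool" where
  "subdivision_limit \<alpha> c F \<longleftrightarrow>
     continuous_on UNIV F \<and>
     (\<lambda>k. sup_norm (\<lambda>j. (refine \<alpha> ^^ k) c j - F (of_int j / 2 ^ k))) \<longlonglongrightarrow> 0"

definition convergent_scheme :: "sequence \<Rightarrow> bool" where
  "convergent_scheme \<alpha> \<longleftrightarrow>
     (\<forall>c. bounded (range c) \<longrightarrow> (\<exists>F. subdivision_limit \<alpha> c F)) \<and>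
     (\<exists>c F. bounded (range c) \<and> subdivision_limit \<alpha> c F \<and> (\<exists>x. F x \<noteq> 0))"

definition decimate :: "sequence \<Rightarrow> sequence \<Rightarrow> sequence" where
  "decimate \<gamma> c = (\<lambda>j. \<Sum>\<^sub>\<infinity>k. \<gamma> (j - k) * c (2 * k))"


(* The zeros of p on the unit circle are pushed radially outwards by the factor 1 + xi;
   normalisation to the value 1 at z = 1 follows in pseudo_inv. *)
definition displaced_poly :: "real \<Rightarrow> complex poly \<Rightarrow> complex poly" where
  "displaced_poly \<xi> p =
     (\<Prod>r\<in>#filter_mset (\<lambda>r. norm r \<noteq> 1) (proots p). [:- r, 1:]) *
     (\<Prod>r\<in>#filter_mset (\<lambda>r. norm r = 1) (proots p). [:- (of_real (1 + \<xi>) * r), 1:])"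

definition pseudo_inv :: "real \<Rightarrow> complex poly \<Rightarrow> complex poly" where
  "pseudo_inv \<xi> p = smult (inverse (poly (displaced_poly \<xi> p) 1)) (displaced_poly \<xi> p)"

definition laurent_form :: "sequence \<Rightarrow> int \<Rightarrow> complex poly \<Rightarrow> bool" where
  "laurent_form b m q \<longleftrightarrow>
     poly q 0 \<noteq> 0 \<and> (\<forall>z. z \<noteq> 0 \<longrightarrow> symbol b z = z powi (- m) * poly q z)"

(* m and q are uniquely determined by the mask. As gamma is absolutely summable, the identity
   of symbols on the unit circle says that gamma is the sequence of Fourier coefficients of
   the right-hand side; these are real because the mask is real. *)
definition pseudo_reverse :: "real \<Rightarrow> sequence \<Rightarrow> sequence \<Rightarrow> bool" where
  "pseudo_reverse \<xi> \<alpha> \<gamma> \<longleftrightarrow>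
     (\<lambda>k. \<bar>\<gamma> k\<bar>) summable_on UNIV \<and>
     (\<exists>m q. laurent_form (downsample \<alpha>) m q \<and>
        (\<forall>z. norm z = 1 \<longrightarrow> symbol \<gamma> z = 1 / (z powi (- m) * poly (pseudo_inv \<xi> q) z)))"


(* The represented sequence is c J. The values c l for l > J and d l for l = 0 or l > J
   are irrelevant. *)
definition multiscale_representation ::
  "sequence \<Rightarrow> sequence \<Rightarrow> nat \<Rightarrow> (nat \<Rightarrow> sequence) \<Rightarrow> (nat \<Rightarrow> sequence) \<Rightarrow> bool" where
  "multiscale_representation \<alpha> \<gamma> J c d \<longleftrightarrow>
     (\<forall>l\<in>{1..J}.
        (\<forall>j. (\<lambda>k. \<bar>\<gamma> (j - k) * c l (2 * k)\<bar>) summable_on UNIV) \<and>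
        c (l - 1) = decimate \<gamma> (c l) \<and>
        d l = (\<lambda>j. c l j - refine \<alpha> (c (l - 1)) j))"

primrec synthesize :: "sequence \<Rightarrow> sequence \<Rightarrow> (nat \<Rightarrow> sequence) \<Rightarrow> nat \<Rightarrow> sequence" where
  "synthesize \<alpha> c0 q 0 = c0"
| "synthesize \<alpha> c0 q (Suc l) = (\<lambda>j. refine \<alpha> (synthesize \<alpha> c0 q l) j + q (Suc l) j)"

definition zero_even :: "sequence \<Rightarrow> sequence" where
  "zero_even b = (\<lambda>j. if even j then 0 else b j)"

end

theory Submission
  imports Defs
begin

text \<open>
  The error \<open>e l = c l - \<zeta> l\<close> starts at \<open>e 0 = 0\<close> and satisfies \<open>e l = S (e (l - 1)) + p l\<close>,
  where \<open>p l\<close> is \<open>d l\<close> with the odd entries set to zero. Hence \<open>e J\<close> is the sum of the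
  \<open>S^(J - l) (p l)\<close>, and it suffices to bound the powers of \<open>S\<close> uniformly on bounded sequences.
  If the mask is supported in \<open>[-N, N]\<close>, then \<open>S^k \<delta>\<close> is supported in \<open>[-2^k N, 2^k N]\<close>, so at
  most \<open>2 N + 2\<close> of its translates by multiples of \<open>2^k\<close> meet a given index, and its entries are
  bounded uniformly in \<open>k\<close> because they approach the values of a continuous function on the
  compact interval \<open>[-N, N]\<close>.
\<close>

section \<open>Extended-real sup norms\<close>

lemma le_sup_norm: "ennreal \<bar>b j\<bar> \<le> sup_norm b"
  unfolding sup_norm_def by (rule SUP_upper) simp

lemma sup_norm_le: "(\<And>j. ennreal \<bar>b j\<bar> \<le> B) \<Longrightarrow> sup_norm b \<le> B"
  unfolding sup_norm_def by (rule SUP_least)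

lemma abs_le_if_sup_norm_le: "sup_norm b \<le> ennreal B \<Longrightarrow> 0 \<le> B \<Longrightarrow> \<bar>b j\<bar> \<le> B"
  using order_trans[OF le_sup_norm, of b "ennreal B" j] by (simp add: ennreal_le_iff)

lemma sup_norm_sum_le:
  assumes "finite I"
  shows "sup_norm (\<lambda>j. \<Sum>i\<in>I. f i j) \<le> (\<Sum>i\<in>I. sup_norm (f i))"
proof (rule sup_norm_le)
  fix j
  have "ennreal \<bar>\<Sum>i\<in>I. f i j\<bar> \<le> ennreal (\<Sum>i\<in>I. \<bar>f i j\<bar>)"
    by (intro ennreal_leI sum_abs)
  also have "\<dots> = (\<Sum>i\<in>I. ennreal \<bar>f i j\<bar>)"
    by (simp add: sum_ennreal)
  also have "\<dots> \<le> (\<Sum>i\<in>I. sup_norm (f i))"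
    by (intro sum_mono le_sup_norm)
  finally show "ennreal \<bar>\<Sum>i\<in>I. f i j\<bar> \<le> (\<Sum>i\<in>I. sup_norm (f i))" .
qed

text \<open>Zeros inserted at odd indices do not change a supremum of absolute values.\<close>

lemma sup_norm_even_part: "sup_norm (\<lambda>j. if even j then b j else 0) = sup_norm (downsample b)"
proof (rule antisym; rule sup_norm_le)
  fix j :: int
  show "ennreal \<bar>if even j then b j else 0\<bar> \<le> sup_norm (downsample b)"
    using le_sup_norm[of "downsample b" "j div 2"] by (auto simp: downsample_def)
  show "ennreal \<bar>downsample b j\<bar> \<le> sup_norm (\<lambda>j. if even j then b j else 0)"
    using le_sup_norm[of "\<lambda>j. if even j then b j else 0" "2 * j"] by (simp add: downsample_def)
qed

section \<open>Refinement with a finitely supported mask: linearity, shifts, locality\<close>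

locale finite_mask =
  fixes \<alpha> :: sequence and N :: int
  assumes N_nonneg: "0 \<le> N" and mask_eq_0: "N < \<bar>k\<bar> \<Longrightarrow> \<alpha> k = 0"
begin

text \<open>Write j = s (j div s) + r with 0 <= r < s and cancel s. The bound on the cardinality
  depends on neither j nor s, so with s = 2^k it is uniform in the refinement level.\<close>

lemma finite_window:
  assumes "0 < (s::int)"
  shows "finite {i. \<bar>j - s * i\<bar> \<le> N * s}" "card {i. \<bar>j - s * i\<bar> \<le> N * s} \<le> nat (2 * N + 2)"
proof -
  have sub: "{i. \<bar>j - s * i\<bar> \<le> N * s} \<subseteq> {j div s - N..j div s + N + 1}"
  proof safe
    fix i assume i: "\<bar>j - s * i\<bar> \<le> N * s"
    have j: "j = s * (j div s) + j mod s" "0 \<le> j mod s" "j mod s < s"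
      using assms by auto
    have i': "j - s * i \<le> N * s" "s * i - j \<le> N * s"
      using i by linarith+
    have "s * (j div s) \<le> s * (i + N)"
      using i' j unfolding distrib_left mult.commute[of s N] by linarith
    moreover have "s * i < s * (j div s + N + 1)"
      using i' j unfolding distrib_left mult.commute[of s N] mult_1_right by linarith
    ultimately show "i \<in> {j div s - N..j div s + N + 1}"
      using assms by simp
  qed
  then show "finite {i. \<bar>j - s * i\<bar> \<le> N * s}"
    by (rule finite_subset) simp
  show "card {i. \<bar>j - s * i\<bar> \<le> N * s} \<le> nat (2 * N + 2)"
    using card_mono[OF _ sub] by (simp add: algebra_simps)
qed

text \<open>The window is wider than the support of the mask, so that \<open>finite_window\<close>
  applies with s = 2; the extra terms vanish. As the sum is finite, linearity holds for all
  sequences, bounded or not.\<close>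

lemma refine_eq_sum: "refine \<alpha> c j = (\<Sum>k | \<bar>j - 2 * k\<bar> \<le> N * 2. \<alpha> (j - 2 * k) * c k)"
proof -
  have "refine \<alpha> c j = infsum (\<lambda>k. \<alpha> (j - 2 * k) * c k) {k. \<bar>j - 2 * k\<bar> \<le> N * 2}"
    unfolding refine_def
    by (rule infsum_cong_neutral) (use N_nonneg in \<open>auto intro!: mask_eq_0\<close>)
  then show ?thesis
    by (simp add: finite_window)
qed

lemma refine_sum:
  assumes "finite I"
  shows "refine \<alpha> (\<lambda>j. \<Sum>i\<in>I. w i * f i j) = (\<lambda>j. \<Sum>i\<in>I. w i * refine \<alpha> (f i) j)"
proof (rule ext)
  fix j
  show "refine \<alpha> (\<lambda>j. \<Sum>i\<in>I. w i * f i j) j = (\<Sum>i\<in>I. w i * refine \<alpha> (f i) j)"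
    unfolding refine_eq_sum sum_distrib_left
    by (subst sum.swap) (simp only: mult.left_commute)
qed

lemma refine_diff: "refine \<alpha> (\<lambda>j. f j - g j) j = refine \<alpha> f j - refine \<alpha> g j"
  unfolding refine_eq_sum by (simp add: right_diff_distrib sum_subtractf)

lemma funpow_refine_sum:
  assumes "finite I"
  shows "(refine \<alpha> ^^ k) (\<lambda>j. \<Sum>i\<in>I. w i * f i j) = (\<lambda>j. \<Sum>i\<in>I. w i * (refine \<alpha> ^^ k) (f i) j)"
  by (induction k) (simp_all add: refine_sum[OF assms])

text \<open>Substitute k - i for k in the defining sum; each refinement step doubles a
  shift.\<close>

lemma refine_shift: "refine \<alpha> (\<lambda>j. f (j - i)) = (\<lambda>j. refine \<alpha> f (j - 2 * i))"
proof (rule ext)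
  fix j
  have "bij (\<lambda>k. k - i)"
    by (rule bij_betw_byWitness[where f' = "\<lambda>k. k + i"]) auto
  from infsum_reindex_bij_betw[OF this, of "\<lambda>k. \<alpha> (j - 2 * i - 2 * k) * f k"]
  show "refine \<alpha> (\<lambda>j. f (j - i)) j = refine \<alpha> f (j - 2 * i)"
    by (simp add: refine_def algebra_simps)
qed

lemma funpow_refine_shift:
  "(refine \<alpha> ^^ k) (\<lambda>j. f (j - i)) = (\<lambda>j. (refine \<alpha> ^^ k) f (j - 2 ^ k * i))"
proof (induction k)
  case (Suc k)
  then show ?case
    using refine_shift[of "(refine \<alpha> ^^ k) f" "2 ^ k * i"] by (simp add: mult.assoc)
qed simp

text \<open>One step reaches m with |j - 2 m| <= N, so the radii of dependence satisfy r(0) = 0 and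
  r(k + 1) = N + 2 r(k), which gives r(k) = N (2^k - 1).\<close>

lemma funpow_refine_cong:
  assumes "\<And>i. \<bar>j - 2 ^ k * i\<bar> \<le> N * (2 ^ k - 1) \<Longrightarrow> u i = v i"
  shows "(refine \<alpha> ^^ k) u j = (refine \<alpha> ^^ k) v j"
  using assms
proof (induction k arbitrary: j)
  case (Suc k)
  have "\<alpha> (j - 2 * m) * (refine \<alpha> ^^ k) u m = \<alpha> (j - 2 * m) * (refine \<alpha> ^^ k) v m" for m
  proof (cases "\<bar>j - 2 * m\<bar> \<le> N")
    case True
    have "(refine \<alpha> ^^ k) u m = (refine \<alpha> ^^ k) v m"
    proof (rule Suc.IH)
      fix i assume i: "\<bar>m - 2 ^ k * i\<bar> \<le> N * (2 ^ k - 1)"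
      have "j - 2 ^ Suc k * i = (j - 2 * m) + 2 * (m - 2 ^ k * i)"
        by simp
      then have "\<bar>j - 2 ^ Suc k * i\<bar> \<le> \<bar>j - 2 * m\<bar> + 2 * \<bar>m - 2 ^ k * i\<bar>"
        by (metis abs_triangle_ineq abs_mult abs_numeral)
      also have "\<dots> \<le> N + 2 * (N * (2 ^ k - 1))"
        using True i by (intro add_mono mult_left_mono) auto
      also have "\<dots> = N * (2 ^ Suc k - 1)"
        by (simp add: algebra_simps)
      finally have "\<bar>j - 2 ^ Suc k * i\<bar> \<le> N * (2 ^ Suc k - 1)" .
      then show "u i = v i"
        by (rule Suc.prems)
    qed
    then show ?thesis
      by simp
  qed (simp add: mask_eq_0)
  then show ?case
    by (simp only: funpow.simps comp_apply
        refine_def[of \<alpha> "(refine \<alpha> ^^ k) u"] refine_def[of \<alpha> "(refine \<alpha> ^^ k) v"])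
qed simp

section \<open>Masks of the iterated scheme and uniform bounds on powers of refinement\<close>

definition impulse_response :: "nat \<Rightarrow> sequence" where
  "impulse_response k = (refine \<alpha> ^^ k) (\<lambda>j. of_bool (j = 0))"

lemma window_mono: "\<bar>x\<bar> \<le> N * (2 ^ k - 1) \<Longrightarrow> \<bar>x\<bar> \<le> N * 2 ^ k"
  using N_nonneg by (simp add: algebra_simps)

lemma impulse_response_eq_0:
  assumes "N * 2 ^ k < \<bar>j\<bar>"
  shows "impulse_response k j = 0"
proof -
  have "impulse_response k j = (refine \<alpha> ^^ k) (\<lambda>_. 0) j"
    unfolding impulse_response_def
    \<comment> \<open>The impulse differs from zero only at i = 0, which lies outside the window of
      j.\<close>
    by (rule funpow_refine_cong) (use assms window_mono[of j k] in \<open>auto simp: of_bool_def\<close>)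
  \<comment> \<open>Linearity for the empty sum.\<close>
  also have "(refine \<alpha> ^^ k) (\<lambda>_. 0) = (\<lambda>_. 0)"
    using funpow_refine_sum[of "{}"] by simp
  finally show ?thesis .
qed

text \<open>By locality, u may be replaced by a finite combination of shifted impulses that agrees
  with it on the window of j; linearity and the shift rule then give the formula for arbitrary
  u.\<close>

lemma funpow_refine_eq_sum:
  "(refine \<alpha> ^^ k) u j =
    (\<Sum>i | \<bar>j - 2 ^ k * i\<bar> \<le> N * 2 ^ k. u i * impulse_response k (j - 2 ^ k * i))"
proof -
  let ?W = "{i. \<bar>j - 2 ^ k * i\<bar> \<le> N * 2 ^ k}"
  have fin: "finite ?W"
    by (rule finite_window) simp
  have "(refine \<alpha> ^^ k) u j = (refine \<alpha> ^^ k) (\<lambda>m. \<Sum>i\<in>?W. u i * of_bool (m - i = 0)) j"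
  proof (rule funpow_refine_cong)
    fix i assume "\<bar>j - 2 ^ k * i\<bar> \<le> N * (2 ^ k - 1)"
    then have "i \<in> ?W"
      using window_mono by simp
    then have "u i = (\<Sum>i'\<in>?W. if i = i' then u i' else 0)"
      using fin by simp
    also have "\<dots> = (\<Sum>i'\<in>?W. u i' * of_bool (i - i' = 0))"
      by (intro sum.cong) auto
    finally show "u i = (\<Sum>i'\<in>?W. u i' * of_bool (i - i' = 0))" .
  qed
  also have "\<dots> = (\<Sum>i\<in>?W. u i * (refine \<alpha> ^^ k) (\<lambda>m. of_bool (m - i = 0)) j)"
    by (rule fun_cong[OF funpow_refine_sum[OF fin]])
  also have "\<dots> = (\<Sum>i\<in>?W. u i * impulse_response k (j - 2 ^ k * i))"
    by (simp only: impulse_response_def funpow_refine_shift[of k "\<lambda>m. of_bool (m = 0)"])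
  finally show ?thesis .
qed

lemma impulse_response_bounded:
  assumes "convergent_scheme \<alpha>"
  obtains B where "0 \<le> B" "\<And>k j. \<bar>impulse_response k j\<bar> \<le> B"
proof -
  have "bounded (range (\<lambda>j::int. of_bool (j = 0) :: real))"
    by (rule boundedI[of _ 1]) auto
  then obtain F where F: "subdivision_limit \<alpha> (\<lambda>j. of_bool (j = 0)) F"
    using assms unfolding convergent_scheme_def by blast
  have "compact (F ` {- of_int N..of_int N})"
    using F by (intro compact_continuous_image)
      (auto simp: subdivision_limit_def intro: continuous_on_subset)
  from compact_imp_bounded[OF this]
  obtain A where A: "\<And>x. x \<in> {- of_int N..of_int N} \<Longrightarrow> \<bar>F x\<bar> \<le> A"
    unfolding bounded_iff by (metis imageI real_norm_def)
  have "\<forall>\<^sub>F k in sequentially.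
      sup_norm (\<lambda>j. impulse_response k j - F (of_int j / 2 ^ k)) < 1"
    using F unfolding subdivision_limit_def impulse_response_def
    by (intro order_tendstoD) auto
  then obtain k0 where k0:
    "\<And>k. k0 \<le> k \<Longrightarrow> sup_norm (\<lambda>j. impulse_response k j - F (of_int j / 2 ^ k)) < 1"
    unfolding eventually_sequentially by blast
  \<comment> \<open>\<open>M k\<close> is a crude bound for a single level, used for the finitely
    many levels below \<open>k0\<close>, where the limit function gives no control.\<close>
  define M where "M k = (\<Sum>j | \<bar>j\<bar> \<le> N * 2 ^ k. \<bar>impulse_response k j\<bar>)" for k
  have M_nonneg: "0 \<le> M k" for k
    unfolding M_def by (simp add: sum_nonneg)
  have fin: "finite {j. \<bar>j\<bar> \<le> N * 2 ^ k}" for k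
    by (rule finite_subset[of _ "{- (N * 2 ^ k)..N * 2 ^ k}"]) auto
  \<comment> \<open>The part \<open>\<bar>A\<bar> + 1\<close> covers levels from \<open>k0\<close>
    on, the sum covers those below. Both are nonnegative, so one bound serves every case.\<close>
  have "\<bar>impulse_response k j\<bar> \<le> \<bar>A\<bar> + 1 + (\<Sum>k<k0. M k)" for k j
  proof (cases "\<bar>j\<bar> \<le> N * 2 ^ k")
    case j: True
    show ?thesis
    proof (cases "k0 \<le> k")
      case True
      have "\<bar>impulse_response k j - F (of_int j / 2 ^ k)\<bar> \<le> 1"
        using abs_le_if_sup_norm_le[of "\<lambda>j. impulse_response k j - F (of_int j / 2 ^ k)" 1] k0[OF True]
        by (simp add: less_imp_le)
      \<comment> \<open>The support of the impulse response corresponds to grid points in [-N, N],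
        where F is bounded by A.\<close>
      moreover have "\<bar>of_int j / 2 ^ k :: real\<bar> \<le> of_int N"
      proof -
        have "\<bar>of_int j :: real\<bar> \<le> of_int N * 2 ^ k"
          using of_int_le_iff[where 'a = real, THEN iffD2, OF j] by simp
        then show ?thesis
          by (simp add: divide_le_eq)
      qed
      then have "\<bar>F (of_int j / 2 ^ k)\<bar> \<le> A"
        by (intro A) (metis abs_le_iff atLeastAtMost_iff minus_le_iff)
      moreover have "0 \<le> (\<Sum>k<k0. M k)"
        by (intro sum_nonneg M_nonneg)
      ultimately show ?thesis
        by linarith
    next
      case False
      have "\<bar>impulse_response k j\<bar> \<le> M k"
        unfolding M_def using j fin by (intro member_le_sum) auto
      also have "\<dots> \<le> (\<Sum>k<k0. M k)"
        using False by (intro member_le_sum M_nonneg) auto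
      finally show ?thesis
        by simp
    qed
  next
    case False
    moreover have "0 \<le> (\<Sum>k<k0. M k)"
      by (intro sum_nonneg M_nonneg)
    ultimately show ?thesis
      by (simp add: impulse_response_eq_0)
  qed
  moreover have "0 \<le> \<bar>A\<bar> + 1 + (\<Sum>k<k0. M k)"
    by (intro add_nonneg_nonneg sum_nonneg M_nonneg) auto
  ultimately show ?thesis
    by (rule that[rotated])
qed

lemma funpow_refine_bounded:
  assumes "convergent_scheme \<alpha>"
  obtains C where "0 < C" "\<And>k u. sup_norm ((refine \<alpha> ^^ k) u) \<le> ennreal C * sup_norm u"
proof -
  obtain B where B: "0 \<le> B" "\<And>k j. \<bar>impulse_response k j\<bar> \<le> B"
    using impulse_response_bounded[OF assms] by blast
  \<comment> \<open>At most 2 N + 2 translates contribute, each at most B times the norm of u;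
    adding 1 makes C positive even if B = 0.\<close>
  define C where "C = of_int (2 * N + 2) * B + 1"
  have C: "0 < C"
    using B N_nonneg by (auto simp: C_def intro!: add_nonneg_pos mult_nonneg_nonneg)
  have "sup_norm ((refine \<alpha> ^^ k) u) \<le> ennreal C * sup_norm u" for k u
  proof (cases "sup_norm u")
    case (real U)
    have u: "\<bar>u i\<bar> \<le> U" for i
      using real by (intro abs_le_if_sup_norm_le) auto
    show ?thesis
    proof (rule sup_norm_le)
      fix j
      let ?W = "{i. \<bar>j - 2 ^ k * i\<bar> \<le> N * 2 ^ k}"
      have card: "real (card ?W) \<le> of_int (2 * N + 2)"
        using finite_window(2)[of "2 ^ k" j] N_nonneg by simp
      have "\<bar>(refine \<alpha> ^^ k) u j\<bar> \<le> (\<Sum>i\<in>?W. \<bar>u i * impulse_response k (j - 2 ^ k * i)\<bar>)"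
        unfolding funpow_refine_eq_sum by (rule sum_abs)
      also have "\<dots> \<le> (\<Sum>i\<in>?W. U * B)"
        unfolding abs_mult using B real by (intro sum_mono mult_mono u) auto
      also have "\<dots> = real (card ?W) * (U * B)"
        by simp
      also have "\<dots> \<le> of_int (2 * N + 2) * (U * B)"
        using B real by (intro mult_right_mono card) auto
      also have "\<dots> \<le> C * U"
        using real by (simp add: C_def algebra_simps)
      finally have "ennreal \<bar>(refine \<alpha> ^^ k) u j\<bar> \<le> ennreal (C * U)"
        by (rule ennreal_leI)
      then show "ennreal \<bar>(refine \<alpha> ^^ k) u j\<bar> \<le> ennreal C * sup_norm u"
        using real C by (simp add: ennreal_mult)
    qed
  next
    \<comment> \<open>An infinite norm of u makes the right-hand side infinite, because C >
      0.\<close>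
    case top
    then show ?thesis
      using C by (simp add: ennreal_mult_top)
  qed
  with C show ?thesis
    by (rule that)
qed

section \<open>Propagation of the discarded even details through the synthesis\<close>

lemma synthesis_error:
  assumes "\<And>l j. l < J \<Longrightarrow> c (Suc l) j = refine \<alpha> (c l) j + d (Suc l) j"
  shows "(\<lambda>j. c J j - synthesize \<alpha> (c 0) (\<lambda>l. zero_even (d l)) J j) =
    (\<lambda>j. \<Sum>l=1..J. (refine \<alpha> ^^ (J - l)) (\<lambda>j. if even j then d l j else 0) j)"
  using assms
proof (induction J)
  case (Suc J)
  let ?z = "synthesize \<alpha> (c 0) (\<lambda>l. zero_even (d l)) J"
  let ?e = "\<lambda>l j. if even j then d l j else 0"
  show ?case
  proof (rule ext)
    fix j
    have "c (Suc J) j - synthesize \<alpha> (c 0) (\<lambda>l. zero_even (d l)) (Suc J) j =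
        refine \<alpha> (\<lambda>j. c J j - ?z j) j + ?e (Suc J) j"
      by (simp add: Suc.prems refine_diff zero_even_def)
    \<comment> \<open>The factor 1 brings the induction hypothesis into the weighted form of
      \<open>refine_sum\<close>.\<close>
    also have "refine \<alpha> (\<lambda>j. c J j - ?z j) j =
        refine \<alpha> (\<lambda>j. \<Sum>l=1..J. 1 * (refine \<alpha> ^^ (J - l)) (?e l) j) j"
      using Suc by simp
    also have "\<dots> = (\<Sum>l=1..J. refine \<alpha> ((refine \<alpha> ^^ (J - l)) (?e l)) j)"
      by (subst refine_sum) simp_all
    also have "\<dots> = (\<Sum>l=1..J. (refine \<alpha> ^^ (Suc J - l)) (?e l) j)"
      by (intro sum.cong) (simp_all add: Suc_diff_le)
    \<comment> \<open>The new even part is the term l = J + 1, with the zeroth power of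
      refinement.\<close>
    also have "\<dots> + ?e (Suc J) j = (\<Sum>l=1..Suc J. (refine \<alpha> ^^ (Suc J - l)) (?e l) j)"
      by simp
    finally show "c (Suc J) j - synthesize \<alpha> (c 0) (\<lambda>l. zero_even (d l)) (Suc J) j =
        (\<Sum>l=1..Suc J. (refine \<alpha> ^^ (Suc J - l)) (?e l) j)" .
  qed
qed simp

end

theorem theorem3p5:
  fixes \<alpha> \<gamma> :: "int \<Rightarrow> real" and \<xi> :: real
  assumes "refinement_mask \<alpha>"
    and "convergent_scheme \<alpha>"
    and "\<xi> > 0"
    and "pseudo_reverse \<xi> \<alpha> \<gamma>"
  shows "\<exists>C::real. C > 0 \<and>
    (\<forall>(J::nat) (c :: nat \<Rightarrow> int \<Rightarrow> real) (d :: nat \<Rightarrow> int \<Rightarrow> real).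
       multiscale_representation \<alpha> \<gamma> J c d \<longrightarrow>
       sup_norm (\<lambda>j. c J j - synthesize \<alpha> (c 0) (\<lambda>l. zero_even (d l)) J j)
         \<le> ennreal C * (\<Sum>l=1..J. sup_norm (downsample (d l))))"
proof -
  have "finite (abs ` {k. \<alpha> k \<noteq> 0})"
    using assms(1) by (simp add: refinement_mask_def)
  then obtain M where M: "\<And>k. \<alpha> k \<noteq> 0 \<Longrightarrow> \<bar>k\<bar> \<le> M"
    using bdd_above_finite[of "abs ` {k. \<alpha> k \<noteq> 0}"] unfolding bdd_above_def by auto
  \<comment> \<open>The bound M carries no sign information, hence the radius
    \<open>\<bar>M\<bar>\<close>.\<close>
  interpret finite_mask \<alpha> "\<bar>M\<bar>"
  proof
    fix k assume "\<bar>M\<bar> < \<bar>k\<bar>"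
    then show "\<alpha> k = 0"
      using M[of k] by linarith
  qed simp
  \<comment> \<open>C is fixed before J, c and d, so it depends on the mask alone.\<close>
  obtain C where C: "0 < C" "\<And>k u. sup_norm ((refine \<alpha> ^^ k) u) \<le> ennreal C * sup_norm u"
    using funpow_refine_bounded[OF assms(2)] by blast
  have "sup_norm (\<lambda>j. c J j - synthesize \<alpha> (c 0) (\<lambda>l. zero_even (d l)) J j)
      \<le> ennreal C * (\<Sum>l=1..J. sup_norm (downsample (d l)))"
    if rep: "multiscale_representation \<alpha> \<gamma> J c d" for J c d
  proof -
    let ?e = "\<lambda>l j. if even j then d l j else 0"
    have "c (Suc l) j = refine \<alpha> (c l) j + d (Suc l) j" if "l < J" for l j
    proof -
      have "Suc l \<in> {1..J}"
        using that by simp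
      with rep have "d (Suc l) = (\<lambda>j. c (Suc l) j - refine \<alpha> (c (Suc l - 1)) j)"
        unfolding multiscale_representation_def by blast
      then show ?thesis
        by simp
    qed
    then have "sup_norm (\<lambda>j. c J j - synthesize \<alpha> (c 0) (\<lambda>l. zero_even (d l)) J j) =
        sup_norm (\<lambda>j. \<Sum>l=1..J. (refine \<alpha> ^^ (J - l)) (?e l) j)"
      by (subst synthesis_error) auto
    also have "\<dots> \<le> (\<Sum>l=1..J. sup_norm ((refine \<alpha> ^^ (J - l)) (?e l)))"
      by (rule sup_norm_sum_le) simp
    also have "\<dots> \<le> (\<Sum>l=1..J. ennreal C * sup_norm (?e l))"
      by (intro sum_mono C)
    also have "\<dots> = ennreal C * (\<Sum>l=1..J. sup_norm (downsample (d l)))"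
      by (simp add: sup_norm_even_part sum_distrib_left)
    finally show ?thesis .
  qed
  with C(1) show ?thesis
    by blast
qed

end
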